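(* For rational numbers $p_i,q_i,r_i$ ($i=1,2$) put \begin{align*} a&=(p_1^2+p_2^2)(r_1^2+r_2^2)q_1q_2,\\ b&=(q_1^2+q_2^2)(r_1^2+r_2^2)p_1p_2,\\ c&=(q_1^2+q_2^2)(p_1^2+p_2^2)r_1r_2,\\ d&=(p_1q_1r_2+p_1q_2r_1+p_2q_1r_1-p_2q_2r_2)(p_1q_1r_1-p_1q_2r_2-p_2q_1r_2-p_2q_2r_1),\\ e&=(r_1^2+r_2^2)(p_1q_2+p_2q_1)(p_1q_1-p_2q_2),\\ f&=(q_1^2+q_2^2)(p_1r_2+p_2r_1)(p_1r_1-p_2r_2),\\ K&=(p_1q_1-p_2q_2)(p_1q_2+p_2q_1)(p_1r_1-p_2r_2)(p_1r_2+p_2r_1)(q_1r_1-q_2r_2)(q_1r_2+q_2r_1). \end{align*} (i) If $p_i,q_i,r_i$ are positive rational numbers with $q_1>q_2r_2/r_1$ and $p_1>p_2(q_1r_2+q_2r_1)/(q_1r_1-q_2r_2)$, then there is a rational convex cyclic quadrilateral $OABC$ with sides $OA=a$, $AB=b$, $BC=c$, $OC=d$, diagonals $OB=e$, $AC=f$, and area $K$. (ii) These formulae give a complete parametrization of all rational cyclic quadrilaterals: for every rational convex cyclic quadrilateral $OABC$ there exist rational numbers $p_1,p_2,q_1,q_2,r_1,r_2$ and a positive rational number $\lambda$ such that $OA=\lambda a$, $AB=\lambda b$, $BC=\lambda c$, $OC=\lambda d$, $OB=\lambda e$, $AC=\lambda f$, and the area is $\lambda^2K$.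
   Context: A quadrilateral is called rational if the lengths of its four sides, the lengths of its two diagonals and its area are all rational numbers. A quadrilateral is cyclic if its four vertices lie on a circle. $OABC$ denotes a quadrilateral with vertices in this cyclic order, nondegenerate. *)

theory Defs
  imports "HOL-Analysis.Analysis"
begin

definition quad_boundary :: "real^2 \<Rightarrow> real^2 \<Rightarrow> real^2 \<Rightarrow> real^2 \<Rightarrow> (real^2) set" where
  "quad_boundary O' A B C =
     closed_segment O' A \<union> closed_segment A B \<union> closed_segment B C \<union> closed_segment C O'"

definition quad_region :: "real^2 \<Rightarrow> real^2 \<Rightarrow> real^2 \<Rightarrow> real^2 \<Rightarrow> (real^2) set" where
  "quad_region O' A B C = quad_boundary O' A B C \<union> inside (quad_boundary O' A B C)"

(* A nondegenerate simple quadrilateral with vertices in this cyclic order.  Any three of the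
   four vertices are consecutive, so the collinearity conditions also force adjacent sides to meet
   only in their common vertex. *)
definition quadrilateral :: "real^2 \<Rightarrow> real^2 \<Rightarrow> real^2 \<Rightarrow> real^2 \<Rightarrow> bool" where
  "quadrilateral O' A B C \<longleftrightarrow>
     \<not> collinear {O', A, B} \<and> \<not> collinear {A, B, C} \<and>
     \<not> collinear {B, C, O'} \<and> \<not> collinear {C, O', A} \<and>
     closed_segment O' A \<inter> closed_segment B C = {} \<and>
     closed_segment A B \<inter> closed_segment C O' = {}"

definition convex_quadrilateral :: "real^2 \<Rightarrow> real^2 \<Rightarrow> real^2 \<Rightarrow> real^2 \<Rightarrow> bool" where
  "convex_quadrilateral O' A B C \<longleftrightarrow> quadrilateral O' A B C \<and> convex (quad_region O' A B C)"

definition cyclic_quadrilateral :: "real^2 \<Rightarrow> real^2 \<Rightarrow> real^2 \<Rightarrow> real^2 \<Rightarrow> bool" where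
  "cyclic_quadrilateral O' A B C \<longleftrightarrow>
     quadrilateral O' A B C \<and> (\<exists>z \<rho>. \<rho> > 0 \<and> {O', A, B, C} \<subseteq> sphere z \<rho>)"

definition quad_area :: "real^2 \<Rightarrow> real^2 \<Rightarrow> real^2 \<Rightarrow> real^2 \<Rightarrow> real" where
  "quad_area O' A B C = measure lebesgue (quad_region O' A B C)"

definition rational_quadrilateral :: "real^2 \<Rightarrow> real^2 \<Rightarrow> real^2 \<Rightarrow> real^2 \<Rightarrow> bool" where
  "rational_quadrilateral O' A B C \<longleftrightarrow>
     quadrilateral O' A B C \<and>
     dist O' A \<in> \<rat> \<and> dist A B \<in> \<rat> \<and> dist B C \<in> \<rat> \<and> dist O' C \<in> \<rat> \<and>
     dist O' B \<in> \<rat> \<and> dist A C \<in> \<rat> \<and>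
     quad_area O' A B C \<in> \<rat>"

definition par_a :: "rat \<Rightarrow> rat \<Rightarrow> rat \<Rightarrow> rat \<Rightarrow> rat \<Rightarrow> rat \<Rightarrow> rat" where
  "par_a p1 p2 q1 q2 r1 r2 = (p1^2 + p2^2) * (r1^2 + r2^2) * q1 * q2"

definition par_b :: "rat \<Rightarrow> rat \<Rightarrow> rat \<Rightarrow> rat \<Rightarrow> rat \<Rightarrow> rat \<Rightarrow> rat" where
  "par_b p1 p2 q1 q2 r1 r2 = (q1^2 + q2^2) * (r1^2 + r2^2) * p1 * p2"

definition par_c :: "rat \<Rightarrow> rat \<Rightarrow> rat \<Rightarrow> rat \<Rightarrow> rat \<Rightarrow> rat \<Rightarrow> rat" where
  "par_c p1 p2 q1 q2 r1 r2 = (q1^2 + q2^2) * (p1^2 + p2^2) * r1 * r2"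

definition par_d :: "rat \<Rightarrow> rat \<Rightarrow> rat \<Rightarrow> rat \<Rightarrow> rat \<Rightarrow> rat \<Rightarrow> rat" where
  "par_d p1 p2 q1 q2 r1 r2 =
     (p1*q1*r2 + p1*q2*r1 + p2*q1*r1 - p2*q2*r2) *
     (p1*q1*r1 - p1*q2*r2 - p2*q1*r2 - p2*q2*r1)"

definition par_e :: "rat \<Rightarrow> rat \<Rightarrow> rat \<Rightarrow> rat \<Rightarrow> rat \<Rightarrow> rat \<Rightarrow> rat" where
  "par_e p1 p2 q1 q2 r1 r2 = (r1^2 + r2^2) * (p1*q2 + p2*q1) * (p1*q1 - p2*q2)"

definition par_f :: "rat \<Rightarrow> rat \<Rightarrow> rat \<Rightarrow> rat \<Rightarrow> rat \<Rightarrow> rat \<Rightarrow> rat" where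
  "par_f p1 p2 q1 q2 r1 r2 = (q1^2 + q2^2) * (p1*r2 + p2*r1) * (p1*r1 - p2*r2)"

definition par_K :: "rat \<Rightarrow> rat \<Rightarrow> rat \<Rightarrow> rat \<Rightarrow> rat \<Rightarrow> rat \<Rightarrow> rat" where
  "par_K p1 p2 q1 q2 r1 r2 =
     (p1*q1 - p2*q2) * (p1*q2 + p2*q1) * (p1*r1 - p2*r2) * (p1*r2 + p2*r1) *
     (q1*r1 - q2*r2) * (q1*r2 + q2*r1)"

end

theory Submission
  imports Defs
begin

text \<open>
  Let the four vertices lie on a circle of diameter \<open>D\<close>, and let the arcs over \<open>OA\<close>, \<open>AB\<close>, \<open>BC\<close>
  have central angles \<open>2 \<alpha>\<close>, \<open>2 \<beta>\<close>, \<open>2 \<gamma>\<close>. A chord is \<open>D\<close> times the sine of half its arc, so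
  all sides and diagonals are \<open>D\<close> times the sine of \<open>\<alpha>\<close>, \<open>\<beta>\<close>, \<open>\<gamma>\<close> or a sum of consecutive ones of
  these, and the area is half the product of the diagonals times the sine of their angle
  \<open>\<alpha> + \<gamma>\<close>. The formulae of the theorem are these expressions in disguise: if \<open>q2 / q1\<close>, \<open>p2 / p1\<close>,
  \<open>r2 / r1\<close> are the tangents of \<open>\<alpha> / 2\<close>, \<open>\<beta> / 2\<close>, \<open>\<gamma> / 2\<close>, then \<open>q1\<close> and \<open>q2\<close> are proportional to
  \<open>cos (\<alpha> / 2)\<close> and \<open>sin (\<alpha> / 2)\<close>, and each of the seven polynomials becomes the corresponding
  length (or area) for \<open>D = (p1\<^sup>2 + p2\<^sup>2) (q1\<^sup>2 + q2\<^sup>2) (r1\<^sup>2 + r2\<^sup>2) / 2\<close> (lemma \<open>par_polar\<close>).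

  For (i), the two inequalities say \<open>cos ((\<alpha> + \<gamma>) / 2) > 0\<close> and \<open>cos ((\<alpha> + \<beta> + \<gamma>) / 2) > 0\<close>, hence
  \<open>\<alpha> + \<beta> + \<gamma> < pi\<close>, so that the three arcs leave room for a fourth one on the circle.

  For (ii), it must be shown that \<open>D\<close> and the three half-angle tangents are rational. One has
  \<open>2 K D = e (a b + c d)\<close>, because the diagonal \<open>OB\<close> cuts off two triangles with common
  circumdiameter \<open>D\<close>; so \<open>D\<close> is rational, and with it the sines. The law of cosines makes the
  cosines rational, and \<open>tan (\<theta> / 2) = sin \<theta> / (1 + cos \<theta>)\<close>.

  The geometric content is that a quadrilateral on a circle has its vertices in cyclic order along
  the circle (otherwise two opposite sides cross), and that the region bounded by such a
  quadrilateral is the convex hull of the vertices, whose area is a sum of two triangle areas.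
  Both rest on one criterion: four vertices whose consecutive triples are positively oriented
  (locale \<open>ccw_quadrilateral\<close>).
\<close>

section \<open>Oriented area in the plane\<close>

text \<open>
  Twice the signed area of the triangle \<open>P Q R\<close>.
\<close>
definition orient :: "real^2 \<Rightarrow> real^2 \<Rightarrow> real^2 \<Rightarrow> real" where
  "orient P Q R = (Q$1 - P$1) * (R$2 - P$2) - (Q$2 - P$2) * (R$1 - P$1)"

lemma orient_rotate: "orient Q R P = orient P Q R"
  by (simp add: orient_def algebra_simps)

lemma orient_swap: "orient Q P R = - orient P Q R"
  by (simp add: orient_def algebra_simps)

lemma orient_degenerate [simp]: "orient P P R = 0" "orient P Q P = 0" "orient P Q Q = 0"
  by (simp_all add: orient_def)

lemma orient_affine:
  assumes "u + v = 1"
  shows "orient P Q (u *\<^sub>R x + v *\<^sub>R y) = u * orient P Q x + v * orient P Q y"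
proof -
  have u: "u = 1 - v" using assms by simp
  show ?thesis unfolding u by (simp add: orient_def) algebra
qed

lemma collinear_imp_orient_eq_0:
  assumes "collinear {P, Q, R}"
  shows "orient P Q R = 0"
proof -
  obtain u where "\<forall>x\<in>{P,Q,R}. \<forall>y\<in>{P,Q,R}. \<exists>c. x - y = c *\<^sub>R u"
    using assms by (auto simp: collinear_def)
  then obtain c d where "Q - P = c *\<^sub>R u" "R - P = d *\<^sub>R u" by blast
  then have "Q$i - P$i = c * u$i" "R$i - P$i = d * u$i" for i
    by (metis vector_minus_component vector_scaleR_component real_scaleR_def)+
  then show ?thesis unfolding orient_def by simp
qed

lemma continuous_on_orient: "continuous_on S (orient P Q)"
  unfolding orient_def by (intro continuous_intros)

lemma convex_orient_nonneg: "convex {y. orient P Q y \<ge> 0}"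
  unfolding convex_def by (auto simp: orient_affine)

text \<open>
  The barycentric coordinates of \<open>y\<close> in the triangle \<open>P Q R\<close> are ratios of oriented areas, so
  membership in triangles and their edges can be read off from signs of \<open>orient\<close>.
\<close>
lemma orient_barycentric:
  "orient P Q R *\<^sub>R y = orient Q R y *\<^sub>R P + orient R P y *\<^sub>R Q + orient P Q y *\<^sub>R R"
  by (simp add: vec_eq_iff forall_2 orient_def algebra_simps)

lemma orient_barycentric_sum: "orient Q R y + orient R P y + orient P Q y = orient P Q R"
  by (simp add: orient_def algebra_simps)

lemma orient_barycentric_normalized:
  assumes "orient P Q R > 0"
  shows "y = (orient Q R y / orient P Q R) *\<^sub>R P + (orient R P y / orient P Q R) *\<^sub>R Q + (orient P Q y / orient P Q R) *\<^sub>R R"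
    and "orient Q R y / orient P Q R + orient R P y / orient P Q R + orient P Q y / orient P Q R = 1"
proof -
  have "y = (1 / orient P Q R) *\<^sub>R (orient P Q R *\<^sub>R y)" using assms by simp
  then show "y = (orient Q R y / orient P Q R) *\<^sub>R P + (orient R P y / orient P Q R) *\<^sub>R Q + (orient P Q y / orient P Q R) *\<^sub>R R"
    unfolding orient_barycentric[of P Q R y] by (simp add: scaleR_right_distrib)
  show "orient Q R y / orient P Q R + orient R P y / orient P Q R + orient P Q y / orient P Q R = 1"
    using assms by (simp add: orient_barycentric_sum flip: add_divide_distrib)
qed

lemma in_triangle_if_orient_nonneg:
  assumes "orient P Q R > 0" "orient P Q y \<ge> 0" "orient Q R y \<ge> 0" "orient R P y \<ge> 0"
  shows "y \<in> convex hull {P, Q, R}"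
proof -
  have "orient Q R y / orient P Q R \<ge> 0" "orient R P y / orient P Q R \<ge> 0" "orient P Q y / orient P Q R \<ge> 0"
    using assms by simp_all
  then show ?thesis
    unfolding convex_hull_3 using orient_barycentric_normalized[OF assms(1), of y] by blast
qed

text \<open>
  On the line \<open>P Q\<close> the two remaining sign conditions bound the position of \<open>y\<close> from either end,
  which needs a vertex \<open>R\<close> adjacent to \<open>Q\<close> and a vertex \<open>S\<close> adjacent to \<open>P\<close>.
\<close>
lemma in_edge_if_orient_eq_0:
  assumes "orient P Q R > 0" "orient P Q S > 0" "orient P Q y = 0" "orient Q R y \<ge> 0" "orient S P y \<ge> 0"
  shows "y \<in> closed_segment P Q"
proof -
  define t where "t = orient R P y / orient P Q R"
  have t1: "orient Q R y / orient P Q R = 1 - t"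
    using orient_barycentric_normalized(2)[OF assms(1), of y] assms(3) unfolding t_def by simp
  have y: "y = (1 - t) *\<^sub>R P + t *\<^sub>R Q"
    using orient_barycentric_normalized(1)[OF assms(1), of y] assms(3) unfolding t1 t_def[symmetric]
    by simp
  have "orient S P y = (1 - t) * orient S P P + t * orient S P Q"
    by (subst y, rule orient_affine) simp
  then have "orient S P y = t * orient P Q S" by (simp add: orient_rotate)
  then have "t \<ge> 0" using assms(2,5) by (metis zero_le_mult_iff not_le)
  moreover have "t \<le> 1" using t1 assms(1,4) by (metis diff_ge_0_iff_ge divide_nonneg_pos)
  ultimately show ?thesis using y unfolding closed_segment_def by auto
qed

section \<open>Counterclockwise quadrilaterals\<close>

locale ccw_quadrilateral =
  fixes O' A B C :: "real^2"
  assumes OAB: "orient O' A B > 0" and ABC: "orient A B C > 0" and BCO: "orient B C O' > 0" and COA: "orient C O' A > 0"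
begin

text \<open>
  The diagonal \<open>O' B\<close> decides which of the two triangles contains a point. Together with the two
  trivial inclusions that follow, this identifies the half-plane intersection, the union of the
  triangles and the convex hull.
\<close>
lemma halfplanes_subset_triangles:
  "{y. orient O' A y \<ge> 0 \<and> orient A B y \<ge> 0 \<and> orient B C y \<ge> 0 \<and> orient C O' y \<ge> 0}
    \<subseteq> convex hull {O', A, B} \<union> convex hull {O', B, C}" (is "?H \<subseteq> ?T")
proof
  fix y assume y: "y \<in> ?H"
  show "y \<in> ?T"
  proof (cases "orient B O' y \<ge> 0")
    case True
    then have "y \<in> convex hull {O', A, B}" using y OAB by (intro in_triangle_if_orient_nonneg) auto
    then show ?thesis by simp
  next
    case False
    then have "orient O' B y \<ge> 0" using orient_swap[of B O' y] by simp
    then have "y \<in> convex hull {O', B, C}"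
      using y BCO by (intro in_triangle_if_orient_nonneg) (auto simp: orient_rotate)
    then show ?thesis by simp
  qed
qed

lemma hull_subset_halfplanes:
  "convex hull {O', A, B, C} \<subseteq> {y. orient O' A y \<ge> 0 \<and> orient A B y \<ge> 0 \<and> orient B C y \<ge> 0 \<and> orient C O' y \<ge> 0}"
    (is "?K \<subseteq> ?H")
proof (rule hull_minimal)
  have H: "?H = {y. orient O' A y \<ge> 0} \<inter> {y. orient A B y \<ge> 0} \<inter> {y. orient B C y \<ge> 0} \<inter> {y. orient C O' y \<ge> 0}"
    by auto
  show "convex ?H" unfolding H by (intro convex_Int convex_orient_nonneg)
  show "{O', A, B, C} \<subseteq> ?H"
    using OAB ABC BCO COA by (auto simp: orient_rotate)
qed

lemma triangles_subset_hull:
  "convex hull {O', A, B} \<union> convex hull {O', B, C} \<subseteq> convex hull {O', A, B, C}"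
  by (intro Un_least hull_mono) auto

lemma hull_eq_triangles:
  "convex hull {O', A, B, C} = convex hull {O', A, B} \<union> convex hull {O', B, C}"
  using halfplanes_subset_triangles hull_subset_halfplanes triangles_subset_hull by blast

lemma hull_eq_halfplanes:
  "convex hull {O', A, B, C} = {y. orient O' A y \<ge> 0 \<and> orient A B y \<ge> 0 \<and> orient B C y \<ge> 0 \<and> orient C O' y \<ge> 0}"
  using halfplanes_subset_triangles hull_subset_halfplanes triangles_subset_hull by blast

lemma closed_segment_subset_hull:
  assumes "P \<in> {O', A, B, C}" "Q \<in> {O', A, B, C}"
  shows "closed_segment P Q \<subseteq> convex hull {O', A, B, C}"
  using assms by (intro closed_segment_subset convex_convex_hull) (auto intro: hull_inc)

lemma boundary_subset_hull: "quad_boundary O' A B C \<subseteq> convex hull {O', A, B, C}"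
  unfolding quad_boundary_def by (intro Un_least closed_segment_subset_hull) auto

text \<open>
  Where all four half-plane conditions are strict, the point is interior; where one of them is an
  equality, the point lies on the corresponding side. Thus the frontier of the hull is contained
  in the polygonal boundary.
\<close>
lemma hull_subset_boundary_Un_interior:
  "convex hull {O', A, B, C} \<subseteq> quad_boundary O' A B C \<union> interior (convex hull {O', A, B, C})"
proof
  let ?U = "{y. orient O' A y > 0} \<inter> {y. orient A B y > 0} \<inter> {y. orient B C y > 0} \<inter> {y. orient C O' y > 0}"
  have "open ?U"
    by (intro open_Int open_Collect_less continuous_on_orient continuous_on_const)
  moreover have "?U \<subseteq> convex hull {O', A, B, C}" unfolding hull_eq_halfplanes by auto
  ultimately have U: "?U \<subseteq> interior (convex hull {O', A, B, C})" by (simp add: interior_maximal)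
  fix y assume "y \<in> convex hull {O', A, B, C}"
  then have y: "orient O' A y \<ge> 0" "orient A B y \<ge> 0" "orient B C y \<ge> 0" "orient C O' y \<ge> 0"
    unfolding hull_eq_halfplanes by auto
  have s: "orient O' A y = 0 \<Longrightarrow> y \<in> closed_segment O' A"
    "orient A B y = 0 \<Longrightarrow> y \<in> closed_segment A B"
    "orient B C y = 0 \<Longrightarrow> y \<in> closed_segment B C"
    "orient C O' y = 0 \<Longrightarrow> y \<in> closed_segment C O'"
    using y OAB ABC BCO COA
    by (auto intro: in_edge_if_orient_eq_0[of O' A B C] in_edge_if_orient_eq_0[of A B C O']
        in_edge_if_orient_eq_0[of B C O' A] in_edge_if_orient_eq_0[of C O' A B] simp: orient_rotate)
  show "y \<in> quad_boundary O' A B C \<union> interior (convex hull {O', A, B, C})"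
  proof (cases "y \<in> ?U")
    case True
    then show ?thesis using U by blast
  next
    case False
    then show ?thesis using s y unfolding quad_boundary_def by force
  qed
qed

text \<open>
  The boundary lies in the hull, so it cannot enclose anything outside; and it contains the frontier
  of the hull, so it separates every interior point from infinity.
\<close>
lemma region_eq_hull: "quad_region O' A B C = convex hull {O', A, B, C}" (is "?R = ?K")
proof
  have K: "closed ?K" "bounded ?K"
    by (simp_all add: compact_convex_hull compact_imp_closed compact_imp_bounded)
  \<comment> \<open>The exterior of a convex set is connected and unbounded, and it misses the boundary.\<close>
  have "- ?K \<subseteq> outside (quad_boundary O' A B C)"
    using outside_mono[OF boundary_subset_hull] outside_convex[of ?K] by simp
  then have "inside (quad_boundary O' A B C) \<subseteq> ?K"
    by (auto simp: inside_outside)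
  then show "?R \<subseteq> ?K"
    unfolding quad_region_def using boundary_subset_hull by blast
  have "frontier ?K \<subseteq> quad_boundary O' A B C"
    using hull_subset_boundary_Un_interior K by (auto simp: frontier_def)
  then have "inside (frontier ?K) - quad_boundary O' A B C \<subseteq> inside (quad_boundary O' A B C)"
    by (rule inside_mono)
  then have "interior ?K \<subseteq> quad_region O' A B C"
    unfolding quad_region_def inside_frontier_eq_interior[OF K(2) convex_convex_hull] by blast
  then show "?K \<subseteq> ?R"
    using hull_subset_boundary_Un_interior unfolding quad_region_def by blast
qed

lemma triangles_Int_negligible: "negligible (convex hull {O', A, B} \<inter> convex hull {O', B, C})"
proof (rule negligible_subset)
  let ?a = "vector [O'$2 - B$2, B$1 - O'$1] :: real^2"
  have orient: "orient O' B y = ?a \<bullet> y - ?a \<bullet> O'" for y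
    by (simp add: orient_def inner_vec_def sum_2 algebra_simps)
  have "?a \<noteq> 0"
  proof
    assume "?a = 0"
    then have "orient O' B A = 0" by (simp add: orient)
    then show False using OAB orient_swap[of B O' A] orient_rotate[of B O' A] orient_swap[of O' B A] by (simp add: orient_rotate)
  qed
  then show "negligible {y. ?a \<bullet> y = ?a \<bullet> O'}" by (intro negligible_hyperplane) simp
  have "convex hull {O', A, B} \<subseteq> {y. orient B O' y \<ge> 0}"
    using OAB by (intro hull_minimal convex_orient_nonneg) (auto simp: orient_rotate)
  moreover have "convex hull {O', B, C} \<subseteq> {y. orient O' B y \<ge> 0}"
    using BCO by (intro hull_minimal convex_orient_nonneg) (auto simp: orient_rotate)
  ultimately show "convex hull {O', A, B} \<inter> convex hull {O', B, C} \<subseteq> {y. ?a \<bullet> y = ?a \<bullet> O'}"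
    using orient_swap[of B O'] orient by fastforce
qed

lemma area: "quad_area O' A B C = (orient O' A B + orient O' B C) / 2"
proof -
  have meas: "convex hull {P, Q, R} \<in> lmeasurable" for P Q R :: "real^2"
    by (simp add: measurable_convex convex_convex_hull bounded_convex_hull)
  have tri: "measure lebesgue (convex hull {P, Q, R}) = \<bar>orient P Q R\<bar> / 2" for P Q R :: "real^2"
  proof -
    have "closed (convex hull {P, Q, R})" by (simp add: compact_convex_hull compact_imp_closed)
    then have "measure lebesgue (convex hull {P, Q, R}) = measure lborel (convex hull {P, Q, R})"
      by (intro measure_completion) simp
    then show ?thesis unfolding content_triangle orient_def by (simp add: algebra_simps abs_minus_commute)
  qed
  have "quad_area O' A B C = measure lebesgue (convex hull {O', A, B} \<union> convex hull {O', B, C})"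
    unfolding quad_area_def region_eq_hull hull_eq_triangles ..
  also have "\<dots> = measure lebesgue (convex hull {O', A, B}) + measure lebesgue (convex hull {O', B, C})"
    using measure_Un3[OF meas meas] negligible_imp_measure0[OF triangles_Int_negligible] by simp
  finally show ?thesis using OAB BCO by (simp add: tri orient_rotate)
qed

lemma quadrilateral: "quadrilateral O' A B C"
proof -
  have disj: "closed_segment P Q \<inter> closed_segment R S = {}"
    if "orient P Q R > 0" "orient P Q S > 0" for P Q R S
  proof (rule ccontr)
    assume "closed_segment P Q \<inter> closed_segment R S \<noteq> {}"
    then obtain u v where uv: "0 \<le> u" "u \<le> 1" "0 \<le> v" "v \<le> 1"
      "(1 - u) *\<^sub>R P + u *\<^sub>R Q = (1 - v) *\<^sub>R R + v *\<^sub>R S"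
      by (auto simp: closed_segment_def)
    have "orient P Q ((1 - u) *\<^sub>R P + u *\<^sub>R Q) = 0" by (subst orient_affine) auto
    moreover have "orient P Q ((1 - v) *\<^sub>R R + v *\<^sub>R S) = (1 - v) * orient P Q R + v * orient P Q S"
      by (subst orient_affine) auto
    moreover have "(1 - v) * orient P Q R + v * orient P Q S > 0"
      using that uv by (cases "v = 0") (auto intro: add_nonneg_pos)
    ultimately show False using uv by simp
  qed
  show ?thesis
    unfolding quadrilateral_def
    using OAB ABC BCO COA disj[of O' A B C] disj[of A B C O']
    by (auto dest!: collinear_imp_orient_eq_0 simp: orient_rotate)
qed

lemma convex_quadrilateral: "convex_quadrilateral O' A B C"
  unfolding convex_quadrilateral_def region_eq_hull
  using quadrilateral by (simp add: convex_convex_hull)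

text \<open>
  This excludes the wrong orders of four points on a circle: in those, two opposite sides of the
  quadrilateral would be the diagonals of a counterclockwise one. The intersection divides each
  diagonal in the ratio of the triangles on its two sides.
\<close>
lemma diagonals_meet: "closed_segment O' B \<inter> closed_segment A C \<noteq> {}"
proof -
  define t where "t = orient C O' A / (orient C O' A + orient A B C)"
  define s where "s = orient O' A B / (orient O' A B + orient B C O')"
  have t: "0 \<le> t" "t \<le> 1" "0 \<le> s" "s \<le> 1" using OAB ABC BCO COA by (auto simp: t_def s_def)
  have D: "orient C O' A + orient A B C > 0" and E: "orient O' A B + orient B C O' = orient C O' A + orient A B C"
    using ABC COA by (auto simp: orient_def algebra_simps)
  have "(orient C O' A + orient A B C) *\<^sub>R ((1 - t) *\<^sub>R O' + t *\<^sub>R B) = orient A B C *\<^sub>R O' + orient C O' A *\<^sub>R B"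
    using D by (simp add: t_def scaleR_right_distrib right_diff_distrib)
  also have "\<dots> = orient B C O' *\<^sub>R A + orient O' A B *\<^sub>R C"
    by (simp add: vec_eq_iff forall_2 orient_def) algebra
  also have "\<dots> = (orient C O' A + orient A B C) *\<^sub>R ((1 - s) *\<^sub>R A + s *\<^sub>R C)"
    using D E by (simp add: s_def scaleR_right_distrib right_diff_distrib)
  finally have "(1 - t) *\<^sub>R O' + t *\<^sub>R B = (1 - s) *\<^sub>R A + s *\<^sub>R C" using D by simp
  then show ?thesis using t unfolding closed_segment_def by blast
qed

end

section \<open>Points on a circle\<close>

text \<open>
  The parameter is half the polar angle, so that it measures inscribed rather than central angles
  and has period \<open>pi\<close>.
\<close>
definition circle_pt :: "real^2 \<Rightarrow> real \<Rightarrow> real \<Rightarrow> real^2" where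
  "circle_pt z \<rho> t = z + \<rho> *\<^sub>R vector [cos (2 * t), sin (2 * t)]"

lemma circle_pt_nth [simp]: "circle_pt z \<rho> t $ 1 = z$1 + \<rho> * cos (2 * t)" "circle_pt z \<rho> t $ 2 = z$2 + \<rho> * sin (2 * t)"
  by (simp_all add: circle_pt_def)

lemma dist_circle_pt_center: "\<rho> \<ge> 0 \<Longrightarrow> dist z (circle_pt z \<rho> t) = \<rho>"
proof -
  assume "\<rho> \<ge> 0"
  have "dist z (circle_pt z \<rho> t) ^ 2 = (\<rho> * cos (2 * t))^2 + (\<rho> * sin (2 * t))^2"
    unfolding dist_vec_def L2_set_def by (simp add: sum_2 dist_real_def)
  also have "\<dots> = \<rho>^2"
    using sin_cos_squared_add[of "2 * t"] by algebra
  finally have "dist z (circle_pt z \<rho> t) ^ 2 = \<rho> ^ 2" .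
  then show ?thesis using \<open>\<rho> \<ge> 0\<close> by (simp add: power2_eq_iff_nonneg)
qed

lemma dist_circle_pt:
  assumes "\<rho> \<ge> 0"
  shows "dist (circle_pt z \<rho> s) (circle_pt z \<rho> t) = 2 * \<rho> * \<bar>sin (t - s)\<bar>"
proof -
  have "dist (circle_pt z \<rho> s) (circle_pt z \<rho> t) ^ 2
      = (\<rho> * cos (2 * s) - \<rho> * cos (2 * t))^2 + (\<rho> * sin (2 * s) - \<rho> * sin (2 * t))^2"
    unfolding dist_vec_def L2_set_def by (simp add: sum_2 dist_real_def)
  also have "\<dots> = (2 * \<rho> * sin (t - s))^2"
    unfolding cos_double_sin sin_double sin_diff
    using sin_cos_squared_add[of s] sin_cos_squared_add[of t] by algebra
  finally have "dist (circle_pt z \<rho> s) (circle_pt z \<rho> t) = \<bar>2 * \<rho> * sin (t - s)\<bar>"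
    by (metis abs_of_nonneg real_sqrt_abs zero_le_dist)
  then show ?thesis using assms by (simp add: abs_mult)
qed

text \<open>
  The formula \<open>area = D\<^sup>2 / 2 * sin * sin * sin\<close> for an inscribed triangle, with its sign. It turns the
  order of points along the circle into orientation.
\<close>
lemma orient_circle_pt: "orient (circle_pt z \<rho> s) (circle_pt z \<rho> t) (circle_pt z \<rho> u) = 4 * \<rho>^2 * sin (t - s) * sin (u - t) * sin (u - s)"
proof -
  have c: "cos (2 * a) - cos (2 * b) = - 2 * sin (a - b) * sin (a + b)" for a b :: real
    unfolding cos_double_sin sin_diff sin_add
    using sin_cos_squared_add[of a] sin_cos_squared_add[of b] by algebra
  have s: "sin (2 * a) - sin (2 * b) = 2 * sin (a - b) * cos (a + b)" for a b :: real
    unfolding sin_double sin_diff cos_add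
    using sin_cos_squared_add[of a] sin_cos_squared_add[of b] by algebra
  have "sin (u - t) = sin ((u + s) - (t + s))" by simp
  then have d: "sin (u - t) = sin (u + s) * cos (t + s) - cos (u + s) * sin (t + s)"
    by (simp only: sin_diff)
  have "orient (circle_pt z \<rho> s) (circle_pt z \<rho> t) (circle_pt z \<rho> u)
      = \<rho>^2 * ((cos (2 * t) - cos (2 * s)) * (sin (2 * u) - sin (2 * s))
          - (sin (2 * t) - sin (2 * s)) * (cos (2 * u) - cos (2 * s)))"
    by (simp add: orient_def algebra_simps power2_eq_square)
  then show ?thesis unfolding c s d by (simp add: algebra_simps)
qed

text \<open>
  The freedom in \<open>t0\<close> serves to measure all angles from the first vertex onwards.
\<close>
lemma sphere_obtain_circle_pt:
  assumes "P \<in> sphere z \<rho>" "\<rho> > 0"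
  obtains t where "t0 \<le> t" "t < t0 + pi" "P = circle_pt z \<rho> t"
proof -
  define x where "x = (P$1 - z$1) / \<rho>"
  define y where "y = (P$2 - z$2) / \<rho>"
  have "(z$1 - P$1)^2 + (z$2 - P$2)^2 = (dist z P)^2"
    unfolding dist_vec_def L2_set_def by (simp add: sum_2 dist_real_def)
  then have "(P$1 - z$1)^2 + (P$2 - z$2)^2 = \<rho>^2"
    using assms(1) by (simp add: power2_commute)
  then have xy: "x^2 + y^2 = 1"
    using assms(2) by (simp add: x_def y_def power_divide flip: add_divide_distrib)
  \<comment> \<open>Rotate the point by the angle \<open>- 2 * t0\<close>, so that its polar angle can be taken in \<open>[0, 2 pi)\<close>.\<close>
  have "(x * cos (2*t0) + y * sin (2*t0))^2 + (y * cos (2*t0) - x * sin (2*t0))^2 = 1"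
    using xy sin_cos_squared_add[of "2*t0"] by algebra
  then obtain d where d: "0 \<le> d" "d < 2 * pi"
    "x * cos (2*t0) + y * sin (2*t0) = cos d" "y * cos (2*t0) - x * sin (2*t0) = sin d"
    by (rule sincos_total_2pi)
  define t where "t = t0 + d / 2"
  have "cos (2 * t) = cos (2*t0) * cos d - sin (2*t0) * sin d"
    "sin (2 * t) = sin (2*t0) * cos d + cos (2*t0) * sin d"
    by (simp_all add: t_def distrib_left cos_add sin_add)
  then have "cos (2 * t) = x" "sin (2 * t) = y"
    unfolding d(3,4)[symmetric] using sin_cos_squared_add[of "2*t0"] by algebra+
  then have "P = circle_pt z \<rho> t"
    using assms(2) by (simp add: vec_eq_iff forall_2 x_def y_def)
  moreover have "t0 \<le> t" "t < t0 + pi" using d by (auto simp: t_def)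
  ultimately show ?thesis using that by blast
qed

lemma ccw_quadrilateral_circle_pt:
  assumes "\<rho> > 0" "t0 < t1" "t1 < t2" "t2 < t3" "t3 < t0 + pi"
  shows "ccw_quadrilateral (circle_pt z \<rho> t0) (circle_pt z \<rho> t1) (circle_pt z \<rho> t2) (circle_pt z \<rho> t3)"
proof -
  have pos: "orient (circle_pt z \<rho> s) (circle_pt z \<rho> t) (circle_pt z \<rho> u) > 0" if "s < t" "t < u" "u < s + pi" for s t u
    unfolding orient_circle_pt using that assms(1) by (intro mult_pos_pos sin_gt_zero) auto
  show ?thesis
  proof
    show "orient (circle_pt z \<rho> t2) (circle_pt z \<rho> t3) (circle_pt z \<rho> t0) > 0"
      using pos[of t0 t2 t3] assms by (simp add: orient_rotate)
    show "orient (circle_pt z \<rho> t3) (circle_pt z \<rho> t0) (circle_pt z \<rho> t1) > 0"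
      using pos[of t0 t1 t3] assms by (simp flip: orient_rotate)
  qed (use pos assms in auto)
qed

text \<open>
  The metric description of a cyclic quadrilateral by its circumdiameter and the halves of three of
  its arcs. It is the interface between the geometry and the algebra of the parametrization.
\<close>
definition half_arcs where
  "half_arcs O' A B C D \<alpha> \<beta> \<gamma> \<longleftrightarrow>
     D > 0 \<and> \<alpha> > 0 \<and> \<beta> > 0 \<and> \<gamma> > 0 \<and> \<alpha> + \<beta> + \<gamma> < pi \<and>
     dist O' A = D * sin \<alpha> \<and> dist A B = D * sin \<beta> \<and> dist B C = D * sin \<gamma> \<and>
     dist O' C = D * sin (\<alpha> + \<beta> + \<gamma>) \<and>
     dist O' B = D * sin (\<alpha> + \<beta>) \<and> dist A C = D * sin (\<beta> + \<gamma>) \<and>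
     quad_area O' A B C = D\<^sup>2 / 2 * (sin (\<alpha> + \<beta>) * sin (\<beta> + \<gamma>) * sin (\<alpha> + \<gamma>))"

text \<open>
  After division by the common factor \<open>D\<^sup>2 / 2 * sin (\<alpha> + \<beta>)\<close>, the left side adds the triangles on
  both sides of the diagonal \<open>OB\<close>, and the right side is the symmetric form of the total area.
\<close>
lemma sin_product_identity:
  fixes \<alpha> \<beta> \<gamma> :: real
  shows "sin \<alpha> * sin \<beta> + sin \<gamma> * sin (\<alpha> + \<beta> + \<gamma>) = sin (\<beta> + \<gamma>) * sin (\<alpha> + \<gamma>)"
proof -
  have "cos (\<gamma> - (\<alpha> + \<beta> + \<gamma>)) = cos (\<alpha> + \<beta>)"
    using cos_minus[of "\<alpha> + \<beta>"] by simp
  moreover have "cos (\<beta> + \<gamma> - (\<alpha> + \<gamma>)) = cos (\<alpha> - \<beta>)"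
    using cos_minus[of "\<alpha> - \<beta>"] by simp
  moreover have "\<gamma> + (\<alpha> + \<beta> + \<gamma>) = \<beta> + \<gamma> + (\<alpha> + \<gamma>)" by simp
  ultimately show ?thesis unfolding sin_times_sin by (simp add: field_simps)
qed

lemma half_arcs_circle_pt:
  assumes "\<rho> > 0" "\<alpha> > 0" "\<beta> > 0" "\<gamma> > 0" "\<alpha> + \<beta> + \<gamma> < pi"
  shows "half_arcs (circle_pt z \<rho> t) (circle_pt z \<rho> (t + \<alpha>)) (circle_pt z \<rho> (t + \<alpha> + \<beta>)) (circle_pt z \<rho> (t + \<alpha> + \<beta> + \<gamma>)) (2 * \<rho>) \<alpha> \<beta> \<gamma>"
proof -
  interpret ccw_quadrilateral "circle_pt z \<rho> t" "circle_pt z \<rho> (t + \<alpha>)" "circle_pt z \<rho> (t + \<alpha> + \<beta>)" "circle_pt z \<rho> (t + \<alpha> + \<beta> + \<gamma>)"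
    using assms by (intro ccw_quadrilateral_circle_pt) auto
  have sin: "sin x > 0" if "x \<in> {\<alpha>, \<beta>, \<gamma>, \<alpha> + \<beta> + \<gamma>, \<alpha> + \<beta>, \<beta> + \<gamma>}" for x
    using that assms by (intro sin_gt_zero) auto
  have dist: "dist (circle_pt z \<rho> u) (circle_pt z \<rho> v) = 2 * \<rho> * sin x"
    if "x \<in> {\<alpha>, \<beta>, \<gamma>, \<alpha> + \<beta> + \<gamma>, \<alpha> + \<beta>, \<beta> + \<gamma>}" "v = u + x" for u v x
    using sin[OF that(1)] that(2) assms(1) by (simp add: dist_circle_pt)
  have "quad_area (circle_pt z \<rho> t) (circle_pt z \<rho> (t + \<alpha>)) (circle_pt z \<rho> (t + \<alpha> + \<beta>)) (circle_pt z \<rho> (t + \<alpha> + \<beta> + \<gamma>))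
      = 2 * \<rho>^2 * sin (\<alpha> + \<beta>) * (sin \<alpha> * sin \<beta> + sin \<gamma> * sin (\<alpha> + \<beta> + \<gamma>))"
    unfolding area orient_circle_pt by (simp add: algebra_simps)
  then have "quad_area (circle_pt z \<rho> t) (circle_pt z \<rho> (t + \<alpha>)) (circle_pt z \<rho> (t + \<alpha> + \<beta>)) (circle_pt z \<rho> (t + \<alpha> + \<beta> + \<gamma>))
      = (2 * \<rho>)^2 / 2 * (sin (\<alpha> + \<beta>) * sin (\<beta> + \<gamma>) * sin (\<alpha> + \<gamma>))"
    unfolding sin_product_identity by (simp add: power_mult_distrib)
  then show ?thesis
    unfolding half_arcs_def using assms by (auto intro!: dist)
qed

lemma quad_area_reverse: "quad_area O' C B A = quad_area O' A B C"
  unfolding quad_area_def quad_region_def quad_boundary_def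
  by (simp add: closed_segment_commute Un_ac)

text \<open>
  Traversing the quadrilateral the other way turns \<open>\<alpha>\<close> into the fourth half arc. Every sum of angles
  is replaced by itself or its supplement, which has the same sine; this is how clockwise
  quadrilaterals are reduced to counterclockwise ones.
\<close>
lemma half_arcs_reverse:
  assumes "half_arcs O' C B A D \<alpha> \<beta> \<gamma>"
  shows "half_arcs O' A B C D (pi - (\<alpha> + \<beta> + \<gamma>)) \<gamma> \<beta>"
proof -
  have eq: "pi - (\<alpha> + \<beta> + \<gamma>) + \<gamma> + \<beta> = pi - \<alpha>" "pi - (\<alpha> + \<beta> + \<gamma>) + \<gamma> = pi - (\<alpha> + \<beta>)"
    "pi - (\<alpha> + \<beta> + \<gamma>) + \<beta> = pi - (\<alpha> + \<gamma>)" "\<gamma> + \<beta> = \<beta> + \<gamma>"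
    by auto
  show ?thesis
    using assms unfolding half_arcs_def eq sin_pi_minus quad_area_reverse[of O' A B C]
    by (auto simp: dist_commute)
qed

lemma cyclic_quadrilateral_half_arcs:
  assumes "cyclic_quadrilateral O' A B C"
  obtains D \<alpha> \<beta> \<gamma> where "half_arcs O' A B C D \<alpha> \<beta> \<gamma>"
proof -
  obtain z \<rho> where \<rho>: "\<rho> > 0" and on: "{O', A, B, C} \<subseteq> sphere z \<rho>"
    using assms unfolding cyclic_quadrilateral_def by blast
  have q: "quadrilateral O' A B C" using assms unfolding cyclic_quadrilateral_def by blast
  obtain t where O': "O' = circle_pt z \<rho> t" using sphere_obtain_circle_pt[of O' z \<rho>] on \<rho> by blast
  obtain a where A: "A = circle_pt z \<rho> a" and a: "t \<le> a" "a < t + pi" using sphere_obtain_circle_pt[of A z \<rho>] on \<rho> by blast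
  obtain b where B: "B = circle_pt z \<rho> b" and b: "t \<le> b" "b < t + pi" using sphere_obtain_circle_pt[of B z \<rho>] on \<rho> by blast
  obtain c where C: "C = circle_pt z \<rho> c" and c: "t \<le> c" "c < t + pi" using sphere_obtain_circle_pt[of C z \<rho>] on \<rho> by blast
  have "O' \<noteq> A" "O' \<noteq> B" "O' \<noteq> C" "A \<noteq> B" "A \<noteq> C" "B \<noteq> C"
    using q unfolding quadrilateral_def by (auto simp: insert_commute)
  then have ne: "t < a" "t < b" "t < c" "a \<noteq> b" "a \<noteq> c" "b \<noteq> c"
    using a b c O' A B C by (auto simp: less_le)
  have meet: "closed_segment (circle_pt z \<rho> t) (circle_pt z \<rho> v) \<inter> closed_segment (circle_pt z \<rho> u) (circle_pt z \<rho> w) \<noteq> {}"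
    if "t < u" "u < v" "v < w" "w < t + pi" for u v w
    by (rule ccw_quadrilateral.diagonals_meet[OF ccw_quadrilateral_circle_pt[OF \<rho> that]])
  have disj: "closed_segment O' A \<inter> closed_segment B C = {}" "closed_segment A B \<inter> closed_segment C O' = {}"
    using q unfolding quadrilateral_def by auto
  \<comment> \<open>In each of these four orders two opposite sides join alternate points of the circle, so they would cross.\<close>
  have "\<not> (a < c \<and> c < b)" "\<not> (b < c \<and> c < a)" "\<not> (c < a \<and> a < b)" "\<not> (b < a \<and> a < c)"
    using meet[of a c b] meet[of b c a] meet[of c a b] meet[of b a c] ne a b c disj
    unfolding O' A B C by (auto simp: closed_segment_commute Int_commute)
  then have "a < b \<and> b < c \<or> c < b \<and> b < a" using ne by linarith
  then show ?thesis
  proof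
    assume "a < b \<and> b < c"
    then have "half_arcs O' A B C (2 * \<rho>) (a - t) (b - a) (c - b)"
      using half_arcs_circle_pt[OF \<rho>, of "a - t" "b - a" "c - b" z t] ne c unfolding O' A B C by simp
    then show ?thesis by (rule that)
  next
    assume "c < b \<and> b < a"
    then have "half_arcs O' C B A (2 * \<rho>) (c - t) (b - c) (a - b)"
      using half_arcs_circle_pt[OF \<rho>, of "c - t" "b - c" "a - b" z t] ne a unfolding O' A B C by simp
    then show ?thesis by (rule that[OF half_arcs_reverse])
  qed
qed

lemma cyclic_convex_quadrilateral_circle_pt:
  assumes "\<rho> > 0" "t0 < t1" "t1 < t2" "t2 < t3" "t3 < t0 + pi"
  shows "cyclic_quadrilateral (circle_pt z \<rho> t0) (circle_pt z \<rho> t1) (circle_pt z \<rho> t2) (circle_pt z \<rho> t3)"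
    and "convex_quadrilateral (circle_pt z \<rho> t0) (circle_pt z \<rho> t1) (circle_pt z \<rho> t2) (circle_pt z \<rho> t3)"
proof -
  interpret ccw_quadrilateral "circle_pt z \<rho> t0" "circle_pt z \<rho> t1" "circle_pt z \<rho> t2" "circle_pt z \<rho> t3"
    by (rule ccw_quadrilateral_circle_pt[OF assms])
  show "convex_quadrilateral (circle_pt z \<rho> t0) (circle_pt z \<rho> t1) (circle_pt z \<rho> t2) (circle_pt z \<rho> t3)"
    by (rule convex_quadrilateral)
  have "{circle_pt z \<rho> t0, circle_pt z \<rho> t1, circle_pt z \<rho> t2, circle_pt z \<rho> t3} \<subseteq> sphere z \<rho>"
    using assms(1) by (auto simp: dist_circle_pt_center)
  then show "cyclic_quadrilateral (circle_pt z \<rho> t0) (circle_pt z \<rho> t1) (circle_pt z \<rho> t2) (circle_pt z \<rho> t3)"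
    unfolding cyclic_quadrilateral_def using quadrilateral assms(1) by blast
qed

section \<open>Half-angle parametrization\<close>

text \<open>
  Half-angle substitution: each factor of the polynomials is a norm, or the real or imaginary part of a
  product, of the complex numbers \<open>q1 + i q2\<close>, \<open>p1 + i p2\<close>, \<open>r1 + i r2\<close>, and a product of a real and an
  imaginary part is a sine of the doubled angle.
\<close>
lemma par_polar:
  fixes p1 p2 q1 q2 r1 r2 :: rat and u v w x y t :: real
  assumes q: "of_rat q1 = v * cos x" "of_rat q2 = v * sin x"
    and p: "of_rat p1 = u * cos y" "of_rat p2 = u * sin y"
    and r: "of_rat r1 = w * cos t" "of_rat r2 = w * sin t"
  defines "D \<equiv> (u * v * w)\<^sup>2 / 2"
  shows "of_rat (par_a p1 p2 q1 q2 r1 r2) = D * sin (2 * x)"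
    and "of_rat (par_b p1 p2 q1 q2 r1 r2) = D * sin (2 * y)"
    and "of_rat (par_c p1 p2 q1 q2 r1 r2) = D * sin (2 * t)"
    and "of_rat (par_d p1 p2 q1 q2 r1 r2) = D * sin (2 * x + 2 * y + 2 * t)"
    and "of_rat (par_e p1 p2 q1 q2 r1 r2) = D * sin (2 * x + 2 * y)"
    and "of_rat (par_f p1 p2 q1 q2 r1 r2) = D * sin (2 * y + 2 * t)"
    and "of_rat (par_K p1 p2 q1 q2 r1 r2) =
           D\<^sup>2 / 2 * (sin (2 * x + 2 * y) * sin (2 * y + 2 * t) * sin (2 * x + 2 * t))"
proof -
  have norm: "(v * cos x)\<^sup>2 + (v * sin x)\<^sup>2 = v\<^sup>2" "(u * cos y)\<^sup>2 + (u * sin y)\<^sup>2 = u\<^sup>2"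
    "(w * cos t)\<^sup>2 + (w * sin t)\<^sup>2 = w\<^sup>2"
    using sin_cos_squared_add[of x] sin_cos_squared_add[of y] sin_cos_squared_add[of t] by algebra+
  note rat = of_rat_mult of_rat_add of_rat_diff of_rat_power q p r norm
  have dbl: "sin (2 * x + 2 * y + 2 * t) = 2 * sin (x + y + t) * cos (x + y + t)"
    "sin (2 * x + 2 * y) = 2 * sin (x + y) * cos (x + y)"
    "sin (2 * y + 2 * t) = 2 * sin (y + t) * cos (y + t)"
    "sin (2 * x + 2 * t) = 2 * sin (x + t) * cos (x + t)"
    using sin_double[of "x + y + t"] sin_double[of "x + y"] sin_double[of "y + t"] sin_double[of "x + t"]
    by (simp_all only: distrib_left)
  have factor: "u * cos y * (v * cos x) - u * sin y * (v * sin x) = u * v * cos (x + y)"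
    "u * cos y * (v * sin x) + u * sin y * (v * cos x) = u * v * sin (x + y)"
    "u * cos y * (w * cos t) - u * sin y * (w * sin t) = u * w * cos (y + t)"
    "u * cos y * (w * sin t) + u * sin y * (w * cos t) = u * w * sin (y + t)"
    "v * cos x * (w * cos t) - v * sin x * (w * sin t) = v * w * cos (x + t)"
    "v * cos x * (w * sin t) + v * sin x * (w * cos t) = v * w * sin (x + t)"
    by (simp_all add: cos_add sin_add algebra_simps)
  show "of_rat (par_a p1 p2 q1 q2 r1 r2) = D * sin (2 * x)"
    unfolding par_a_def rat D_def sin_double by algebra
  show "of_rat (par_b p1 p2 q1 q2 r1 r2) = D * sin (2 * y)"
    unfolding par_b_def rat D_def sin_double by algebra
  show "of_rat (par_c p1 p2 q1 q2 r1 r2) = D * sin (2 * t)"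
    unfolding par_c_def rat D_def sin_double by algebra
  show "of_rat (par_d p1 p2 q1 q2 r1 r2) = D * sin (2 * x + 2 * y + 2 * t)"
    unfolding par_d_def rat D_def dbl unfolding sin_add cos_add by algebra
  show "of_rat (par_e p1 p2 q1 q2 r1 r2) = D * sin (2 * x + 2 * y)"
    unfolding par_e_def rat D_def dbl unfolding sin_add cos_add by algebra
  show "of_rat (par_f p1 p2 q1 q2 r1 r2) = D * sin (2 * y + 2 * t)"
    unfolding par_f_def rat D_def dbl unfolding sin_add cos_add by algebra
  show "of_rat (par_K p1 p2 q1 q2 r1 r2) =
           D\<^sup>2 / 2 * (sin (2 * x + 2 * y) * sin (2 * y + 2 * t) * sin (2 * x + 2 * t))"
    unfolding par_K_def rat factor dbl D_def by (simp add: power2_eq_square)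
qed

lemma polar_first_quadrant:
  fixes a b :: real
  assumes "a > 0" "b > 0"
  obtains v x where "v > 0" "0 < x" "x < pi / 2" "a = v * cos x" "b = v * sin x"
proof -
  define v where "v = sqrt (a\<^sup>2 + b\<^sup>2)"
  have v: "v > 0" "v\<^sup>2 = a\<^sup>2 + b\<^sup>2" using assms by (simp_all add: v_def sum_power2_gt_zero_iff)
  have "(a / v)\<^sup>2 + (b / v)\<^sup>2 = 1"
    using v assms by (simp add: power_divide flip: add_divide_distrib)
  then obtain x where x: "0 \<le> x" "x \<le> pi / 2" "a / v = cos x" "b / v = sin x"
    using sincos_total_pi_half[of "a / v" "b / v"] assms v(1) by auto
  have "cos x > 0" "sin x > 0" using assms v(1) by (auto simp flip: x(3,4))
  then have "x \<noteq> 0" "x \<noteq> pi / 2" using cos_pi_half sin_zero by (metis less_irrefl)+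
  then have "0 < x" "x < pi / 2" using x(1,2) by simp_all
  moreover have "a = v * cos x" "b = v * sin x" using v(1) by (simp_all flip: x(3,4))
  ultimately show ?thesis using v(1) that by blast
qed

text \<open>
  The hypotheses say \<open>cos (x + t) > 0\<close> and \<open>cos (x + t + y) > 0\<close>. The first one is needed to confine
  \<open>x + t + y\<close> to \<open>(0, pi)\<close>, where the sign of the cosine determines the quadrant.
\<close>
lemma half_angle_sum_lt:
  assumes "0 < x" "x < pi / 2" "0 < y" "y < pi / 2" "0 < t" "t < pi / 2"
    and "sin x * sin t < cos x * cos t"
    and "sin y * (cos x * sin t + sin x * cos t) < cos y * (cos x * cos t - sin x * sin t)"
  shows "x + y + t < pi / 2"
proof -
  have *: "z < pi / 2" if "cos z > 0" "z < pi" for z :: real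
    using that cos_monotone_0_pi_le[of "pi / 2" z] pi_gt_zero by (fastforce simp: not_less)
  have "x + t < pi / 2"
    using assms by (intro *) (auto simp: cos_add)
  moreover have "cos (x + t + y) > 0"
    using assms(8) unfolding cos_add[of "x + t"] by (simp add: cos_add sin_add algebra_simps)
  ultimately have "x + t + y < pi / 2" using assms(4) by (intro *) auto
  then show ?thesis by simp
qed

text \<open>
  The law of cosines in the triangle with angles \<open>x\<close>, \<open>y\<close>, \<open>pi - (x + y)\<close> and circumdiameter \<open>D\<close>.
\<close>
lemma cos_in_Rats_if_sines:
  fixes D x y :: real
  assumes "D * sin x \<in> \<rat>" "D * sin y \<in> \<rat>" "D * sin (x + y) \<in> \<rat>"
    and "D \<noteq> 0" "sin y \<noteq> 0" "sin (x + y) \<noteq> 0"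
  shows "cos x \<in> \<rat>"
proof -
  have "2 * sin y * sin (x + y) * cos x = (sin y)\<^sup>2 + (sin (x + y))\<^sup>2 - (sin x)\<^sup>2"
    unfolding sin_add using sin_cos_squared_add[of x] sin_cos_squared_add[of y] by algebra
  then have "D\<^sup>2 * (2 * sin y * sin (x + y) * cos x) = D\<^sup>2 * ((sin y)\<^sup>2 + (sin (x + y))\<^sup>2 - (sin x)\<^sup>2)"
    by simp
  then have "cos x * (2 * (D * sin y) * (D * sin (x + y))) = (D * sin y)\<^sup>2 + (D * sin (x + y))\<^sup>2 - (D * sin x)\<^sup>2"
    by (simp add: power2_eq_square algebra_simps)
  then have "cos x = ((D * sin y)\<^sup>2 + (D * sin (x + y))\<^sup>2 - (D * sin x)\<^sup>2)
      / (2 * (D * sin y) * (D * sin (x + y)))"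
    using assms(4-6) by (simp add: eq_divide_eq)
  then show ?thesis using assms(1-3) by (auto intro!: Rats_divide Rats_diff Rats_add Rats_mult Rats_power)
qed

text \<open>
  The triangles \<open>OAB\<close> and \<open>OBC\<close> have areas \<open>a b e / (2 D)\<close> and \<open>c d e / (2 D)\<close>, as a triangle's area
  is the product of its sides over twice its circumdiameter. Hence \<open>2 D K = e (a b + c d)\<close>.
\<close>
lemma half_arcs_diameter_in_Rats:
  assumes arcs: "half_arcs O' A B C D \<alpha> \<beta> \<gamma>" and rat: "rational_quadrilateral O' A B C"
  shows "D \<in> \<rat>"
proof -
  have pos: "D > 0" "sin (\<alpha> + \<beta>) > 0" "sin \<alpha> > 0" "sin \<beta> > 0" "sin \<gamma> > 0" "sin (\<alpha> + \<beta> + \<gamma>) > 0"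
    using arcs unfolding half_arcs_def by (auto intro!: sin_gt_zero)
  have K: "2 * quad_area O' A B C = D\<^sup>2 * (sin (\<alpha> + \<beta>) * (sin \<alpha> * sin \<beta> + sin \<gamma> * sin (\<alpha> + \<beta> + \<gamma>)))"
    using arcs unfolding half_arcs_def sin_product_identity by simp
  then have "2 * quad_area O' A B C > 0"
    using pos by (auto intro!: mult_pos_pos add_pos_pos)
  moreover have "D * (2 * quad_area O' A B C)
      = dist O' B * (dist O' A * dist A B + dist B C * dist O' C)"
    using arcs unfolding K half_arcs_def by (simp add: power2_eq_square algebra_simps)
  ultimately have "D = dist O' B * (dist O' A * dist A B + dist B C * dist O' C) / (2 * quad_area O' A B C)"
    by (simp add: eq_divide_eq)
  then show ?thesis
    using rat unfolding rational_quadrilateral_def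
    by (metis Rats_add Rats_divide Rats_mult Rats_number_of)
qed

text \<open>
  The witnesses come from \<open>1 + cos \<theta> = 2 cos\<^sup>2 (\<theta> / 2)\<close> and \<open>sin \<theta> = 2 cos (\<theta> / 2) sin (\<theta> / 2)\<close>. The
  modulus \<open>v = 2 cos (\<theta> / 2)\<close> is in general irrational, but only its square enters the polynomials.
\<close>
lemma rat_half_angle:
  assumes "cos \<theta> \<in> \<rat>" "sin \<theta> \<in> \<rat>" "0 < \<theta>" "\<theta> < pi"
  obtains q1 q2 s :: rat and v :: real where
    "of_rat q1 = v * cos (\<theta> / 2)" "of_rat q2 = v * sin (\<theta> / 2)" "v\<^sup>2 = of_rat s" "s > 0"
proof -
  obtain c d :: rat where cd: "cos \<theta> = of_rat c" "sin \<theta> = of_rat d"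
    using assms(1,2) by (auto elim!: Rats_cases)
  define v where "v = 2 * cos (\<theta> / 2)"
  have "of_rat (1 + c) = v * cos (\<theta> / 2)"
    using cos_double_cos[of "\<theta> / 2"] by (simp add: v_def of_rat_add power2_eq_square flip: cd)
  moreover have "of_rat d = v * sin (\<theta> / 2)"
    using sin_double[of "\<theta> / 2"] by (simp add: v_def flip: cd)
  moreover have s: "v\<^sup>2 = of_rat (2 * (1 + c))"
    using cos_double_cos[of "\<theta> / 2"] by (simp add: v_def of_rat_add of_rat_mult power2_eq_square flip: cd)
  moreover have "2 * (1 + c) > 0"
  proof -
    have "cos (\<theta> / 2) > 0" using assms(3,4) by (intro cos_gt_zero) auto
    then have "v\<^sup>2 > 0" by (simp add: v_def)
    then show ?thesis unfolding s by (simp only: zero_less_of_rat_iff)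
  qed
  ultimately show ?thesis by (rule that)
qed

lemma cyclic_from_parameters:
  fixes p1 p2 q1 q2 r1 r2 :: rat
  assumes pos: "p1 > 0" "p2 > 0" "q1 > 0" "q2 > 0" "r1 > 0" "r2 > 0"
    and q: "q1 > q2 * r2 / r1" and p: "p1 > p2 * (q1 * r2 + q2 * r1) / (q1 * r1 - q2 * r2)"
  shows "\<exists>O' A B C :: real^2.
         rational_quadrilateral O' A B C \<and> convex_quadrilateral O' A B C \<and>
         cyclic_quadrilateral O' A B C \<and>
         dist O' A = of_rat (par_a p1 p2 q1 q2 r1 r2) \<and>
         dist A B = of_rat (par_b p1 p2 q1 q2 r1 r2) \<and>
         dist B C = of_rat (par_c p1 p2 q1 q2 r1 r2) \<and>
         dist O' C = of_rat (par_d p1 p2 q1 q2 r1 r2) \<and>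
         dist O' B = of_rat (par_e p1 p2 q1 q2 r1 r2) \<and>
         dist A C = of_rat (par_f p1 p2 q1 q2 r1 r2) \<and>
         quad_area O' A B C = of_rat (par_K p1 p2 q1 q2 r1 r2)"
proof -
  have "q2 * r2 < q1 * r1" using q pos(5) by (simp add: divide_less_eq)
  then have c1: "p2 * (q1 * r2 + q2 * r1) < p1 * (q1 * r1 - q2 * r2)" using p by (simp add: divide_less_eq)
  obtain u y where y: "u > 0" "0 < y" "y < pi / 2" "of_rat p1 = u * cos y" "of_rat p2 = u * sin y"
    using polar_first_quadrant[of "of_rat p1" "of_rat p2"] pos by auto
  obtain v x where x: "v > 0" "0 < x" "x < pi / 2" "of_rat q1 = v * cos x" "of_rat q2 = v * sin x"
    using polar_first_quadrant[of "of_rat q1" "of_rat q2"] pos by auto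
  obtain w t where t: "w > 0" "0 < t" "t < pi / 2" "of_rat r1 = w * cos t" "of_rat r2 = w * sin t"
    using polar_first_quadrant[of "of_rat r1" "of_rat r2"] pos by auto
  have "(of_rat (q2 * r2) :: real) < of_rat (q1 * r1)"
    using \<open>q2 * r2 < q1 * r1\<close> by (simp only: of_rat_less)
  then have "v * w * (sin x * sin t) < v * w * (cos x * cos t)"
    unfolding of_rat_mult x t by (simp add: mult_ac)
  then have c2: "sin x * sin t < cos x * cos t"
    using x(1) t(1) by (simp add: mult_less_cancel_left_pos)
  have "(of_rat (p2 * (q1 * r2 + q2 * r1)) :: real) < of_rat (p1 * (q1 * r1 - q2 * r2))"
    using c1 by (simp only: of_rat_less)
  then have "u * v * w * (sin y * (cos x * sin t + sin x * cos t))
      < u * v * w * (cos y * (cos x * cos t - sin x * sin t))"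
    unfolding of_rat_mult of_rat_add of_rat_diff x y t by (simp add: algebra_simps)
  then have c3: "sin y * (cos x * sin t + sin x * cos t) < cos y * (cos x * cos t - sin x * sin t)"
    using x(1) y(1) t(1) by (simp add: mult_less_cancel_left_pos)
  have sum: "x + y + t < pi / 2"
    using half_angle_sum_lt[OF x(2,3) y(2,3) t(2,3) c2 c3] .
  \<comment> \<open>The circumradius is half the diameter \<open>(u * v * w)\<^sup>2 / 2\<close> occurring in \<open>par_polar\<close>.\<close>
  define \<rho> where "\<rho> = (u * v * w)\<^sup>2 / 4"
  have \<rho>: "\<rho> > 0" and D: "2 * \<rho> = (u * v * w)\<^sup>2 / 2" using x(1) y(1) t(1) by (simp_all add: \<rho>_def)
  let ?O = "circle_pt 0 \<rho> 0" and ?A = "circle_pt 0 \<rho> (0 + 2 * x)" and ?B = "circle_pt 0 \<rho> (0 + 2 * x + 2 * y)"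
    and ?C = "circle_pt 0 \<rho> (0 + 2 * x + 2 * y + 2 * t)"
  have arcs: "half_arcs ?O ?A ?B ?C (2 * \<rho>) (2 * x) (2 * y) (2 * t)"
    using x y t sum by (intro half_arcs_circle_pt[OF \<rho>]) auto
  have cyc: "cyclic_quadrilateral ?O ?A ?B ?C" and conv: "convex_quadrilateral ?O ?A ?B ?C"
    using x y t sum by (intro cyclic_convex_quadrilateral_circle_pt[OF \<rho>]; simp)+
  have vals: "dist ?O ?A = of_rat (par_a p1 p2 q1 q2 r1 r2) \<and>
         dist ?A ?B = of_rat (par_b p1 p2 q1 q2 r1 r2) \<and>
         dist ?B ?C = of_rat (par_c p1 p2 q1 q2 r1 r2) \<and>
         dist ?O ?C = of_rat (par_d p1 p2 q1 q2 r1 r2) \<and>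
         dist ?O ?B = of_rat (par_e p1 p2 q1 q2 r1 r2) \<and>
         dist ?A ?C = of_rat (par_f p1 p2 q1 q2 r1 r2) \<and>
         quad_area ?O ?A ?B ?C = of_rat (par_K p1 p2 q1 q2 r1 r2)"
    using arcs unfolding half_arcs_def par_polar[OF x(4,5) y(4,5) t(4,5)] D by blast
  with cyc have rat: "rational_quadrilateral ?O ?A ?B ?C"
    unfolding rational_quadrilateral_def cyclic_quadrilateral_def by (metis Rats_of_rat)
  then show ?thesis using rat vals cyc conv by blast
qed

lemma parameters_from_cyclic:
  assumes rat: "rational_quadrilateral O' A B C" and cyc: "cyclic_quadrilateral O' A B C"
  shows "\<exists>p1 p2 q1 q2 r1 r2 l :: rat. l > 0 \<and>
         dist O' A = of_rat (l * par_a p1 p2 q1 q2 r1 r2) \<and>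
         dist A B = of_rat (l * par_b p1 p2 q1 q2 r1 r2) \<and>
         dist B C = of_rat (l * par_c p1 p2 q1 q2 r1 r2) \<and>
         dist O' C = of_rat (l * par_d p1 p2 q1 q2 r1 r2) \<and>
         dist O' B = of_rat (l * par_e p1 p2 q1 q2 r1 r2) \<and>
         dist A C = of_rat (l * par_f p1 p2 q1 q2 r1 r2) \<and>
         quad_area O' A B C = of_rat (l^2 * par_K p1 p2 q1 q2 r1 r2)"
proof -
  obtain D \<alpha> \<beta> \<gamma> where arcs: "half_arcs O' A B C D \<alpha> \<beta> \<gamma>"
    using cyclic_quadrilateral_half_arcs[OF cyc] .
  note arcs' = arcs[unfolded half_arcs_def]
  have D: "D > 0" "D \<in> \<rat>" using arcs' half_arcs_diameter_in_Rats[OF arcs rat] by auto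
  have pos: "sin \<alpha> > 0" "sin \<beta> > 0" "sin \<gamma> > 0" "sin (\<alpha> + \<beta>) > 0" "sin (\<beta> + \<gamma>) > 0"
    using arcs' by (auto intro!: sin_gt_zero)
  have chords: "D * sin \<alpha> \<in> \<rat>" "D * sin \<beta> \<in> \<rat>" "D * sin \<gamma> \<in> \<rat>"
    "D * sin (\<alpha> + \<beta>) \<in> \<rat>" "D * sin (\<beta> + \<gamma>) \<in> \<rat>"
    using arcs' rat unfolding rational_quadrilateral_def by metis+
  have sin: "sin x \<in> \<rat>" if "D * sin x \<in> \<rat>" for x
    using Rats_divide[OF that D(2)] D(1) by simp
  have cos: "cos \<alpha> \<in> \<rat>" "cos \<beta> \<in> \<rat>" "cos \<gamma> \<in> \<rat>"
    using cos_in_Rats_if_sines[of D \<alpha> \<beta>] cos_in_Rats_if_sines[of D \<beta> \<gamma>]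
      cos_in_Rats_if_sines[of D \<gamma> \<beta>] chords pos D(1) by (auto simp: add.commute)
  have ang: "0 < \<alpha>" "\<alpha> < pi" "0 < \<beta>" "\<beta> < pi" "0 < \<gamma>" "\<gamma> < pi" using arcs' by auto
  obtain q1 q2 s :: rat and v where q: "of_rat q1 = v * cos (\<alpha> / 2)" "of_rat q2 = v * sin (\<alpha> / 2)"
    "v\<^sup>2 = of_rat s" "s > 0"
    by (rule rat_half_angle[OF cos(1) sin[OF chords(1)] ang(1,2)])
  obtain p1 p2 s' :: rat and u where p: "of_rat p1 = u * cos (\<beta> / 2)" "of_rat p2 = u * sin (\<beta> / 2)"
    "u\<^sup>2 = of_rat s'" "s' > 0"
    by (rule rat_half_angle[OF cos(2) sin[OF chords(2)] ang(3,4)])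
  obtain r1 r2 s'' :: rat and w where r: "of_rat r1 = w * cos (\<gamma> / 2)" "of_rat r2 = w * sin (\<gamma> / 2)"
    "w\<^sup>2 = of_rat s''" "s'' > 0"
    by (rule rat_half_angle[OF cos(3) sin[OF chords(3)] ang(5,6)])
  obtain D' where D': "D = of_rat D'" using D(2) by (auto elim: Rats_cases)
  \<comment> \<open>The parameters alone describe the similar quadrilateral of circumdiameter \<open>E\<close>; the factor \<open>l\<close> is \<open>D / E\<close>.\<close>
  define E where "E = (u * v * w)\<^sup>2 / 2"
  have E: "E = of_rat (s' * s * s'' / 2)"
    unfolding E_def by (simp add: power_mult_distrib p q r of_rat_mult of_rat_divide)
  have E0: "E > 0" unfolding E using p(4) q(4) r(4) by (simp only: zero_less_of_rat_iff) simp
  define l where "l = D' / (s' * s * s'' / 2)"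
  have l: "of_rat l = D / E" unfolding l_def E D' by (simp only: of_rat_divide)
  have l0: "l > 0"
  proof -
    have "(of_rat l :: real) > 0" using l D(1) E0 by simp
    then show ?thesis by (simp only: zero_less_of_rat_iff)
  qed
  note par = par_polar[OF q(1,2) p(1,2) r(1,2), folded E_def]
  have scale: "of_rat l * (E * X) = D * X" "(of_rat l)\<^sup>2 * (E\<^sup>2 / 2 * X) = D\<^sup>2 / 2 * X" for X
    using E0 by (simp_all add: l power_divide)
  have "dist O' A = of_rat (l * par_a p1 p2 q1 q2 r1 r2) \<and>
         dist A B = of_rat (l * par_b p1 p2 q1 q2 r1 r2) \<and>
         dist B C = of_rat (l * par_c p1 p2 q1 q2 r1 r2) \<and>
         dist O' C = of_rat (l * par_d p1 p2 q1 q2 r1 r2) \<and>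
         dist O' B = of_rat (l * par_e p1 p2 q1 q2 r1 r2) \<and>
         dist A C = of_rat (l * par_f p1 p2 q1 q2 r1 r2) \<and>
         quad_area O' A B C = of_rat (l^2 * par_K p1 p2 q1 q2 r1 r2)"
    unfolding of_rat_mult of_rat_power par scale using arcs' by simp
  then show ?thesis using l0 by blast
qed

theorem mainTheorem3:
  "(\<forall>p1 p2 q1 q2 r1 r2 :: rat.
      p1 > 0 \<and> p2 > 0 \<and> q1 > 0 \<and> q2 > 0 \<and> r1 > 0 \<and> r2 > 0 \<and>
      q1 > q2 * r2 / r1 \<and> p1 > p2 * (q1 * r2 + q2 * r1) / (q1 * r1 - q2 * r2) \<longrightarrow>
      (\<exists>O' A B C :: real^2.
         rational_quadrilateral O' A B C \<and> convex_quadrilateral O' A B C \<and>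
         cyclic_quadrilateral O' A B C \<and>
         dist O' A = of_rat (par_a p1 p2 q1 q2 r1 r2) \<and>
         dist A B = of_rat (par_b p1 p2 q1 q2 r1 r2) \<and>
         dist B C = of_rat (par_c p1 p2 q1 q2 r1 r2) \<and>
         dist O' C = of_rat (par_d p1 p2 q1 q2 r1 r2) \<and>
         dist O' B = of_rat (par_e p1 p2 q1 q2 r1 r2) \<and>
         dist A C = of_rat (par_f p1 p2 q1 q2 r1 r2) \<and>
         quad_area O' A B C = of_rat (par_K p1 p2 q1 q2 r1 r2))) \<and>
   (\<forall>O' A B C :: real^2.
      rational_quadrilateral O' A B C \<and> convex_quadrilateral O' A B C \<and>
      cyclic_quadrilateral O' A B C \<longrightarrow>
      (\<exists>p1 p2 q1 q2 r1 r2 l :: rat. l > 0 \<and>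
         dist O' A = of_rat (l * par_a p1 p2 q1 q2 r1 r2) \<and>
         dist A B = of_rat (l * par_b p1 p2 q1 q2 r1 r2) \<and>
         dist B C = of_rat (l * par_c p1 p2 q1 q2 r1 r2) \<and>
         dist O' C = of_rat (l * par_d p1 p2 q1 q2 r1 r2) \<and>
         dist O' B = of_rat (l * par_e p1 p2 q1 q2 r1 r2) \<and>
         dist A C = of_rat (l * par_f p1 p2 q1 q2 r1 r2) \<and>
         quad_area O' A B C = of_rat (l^2 * par_K p1 p2 q1 q2 r1 r2)))"
  by (intro conjI allI impI; elim conjE; rule cyclic_from_parameters parameters_from_cyclic; assumption)

end
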